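(* If $E(\lambda)$ is a (complex) symmetric $n\times n$ matrix pencil with $\operatorname{rank}E=r\leq n$, then it can be written as $$E(\lambda)=(a_1+\lambda b_1)u_1u_1^\top+\cdots+(a_\ell+\lambda b_\ell)u_\ell u_\ell^\top+v_1w_1^\top+\cdots+v_sw_s^\top+w_1v_1^\top+\cdots+w_sv_s^\top,$$ where $a_i,b_i\in\mathbb C$ for $i=1,\dots,\ell$, $u_i,v_j,w_j\in\mathbb C[\lambda]^n$, and (i) $\ell+2s=r$; (ii) $\deg u_1=\cdots=\deg u_\ell=0=\deg v_1=\cdots=\deg v_s$ and $\deg w_1,\dots,\deg w_s\leq 1$.
   Context: A matrix pencil $E(\lambda)=A+\lambda B$ with $A,B\in\mathbb C^{n\times n}$ is symmetric if $A=A^\top$ and $B=B^\top$. Its rank is the normal rank, i.e. the rank as a matrix over the field of rational functions, $\max_{\lambda\in\mathbb C}\operatorname{rank}(A+\lambda B)$. For $v(\lambda)\in\mathbb C[\lambda]^n$, $\deg v$ is the largest degree of the entries of $v$; so $\deg v=0$ means that $v$ is a constant vector in $\mathbb C^n$. *)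

theory Defs
  imports "HOL-Analysis.Analysis" "HOL-Computational_Algebra.Computational_Algebra"
begin

text \<open>The pencil \<open>A + \<lambda>B\<close>, as a matrix over the polynomial ring in the indeterminate \<open>\<lambda>\<close>.\<close>

definition pencil :: "complex^'n^'m \<Rightarrow> complex^'n^'m \<Rightarrow> complex poly^'n^'m"
  where "pencil A B = (\<chi> i j. [:A $ i $ j, B $ i $ j:])"

definition symmetric_mat :: "'a^'n^'n \<Rightarrow> bool"
  where "symmetric_mat A \<longleftrightarrow> A = transpose A"

definition normal_rank :: "complex poly^'n^'m \<Rightarrow> nat"
  where "normal_rank E = rank (map_matrix to_fract E)"

text \<open>\<^term>\<open>degree 0 = 0\<close>, so \<open>vec_degree v = 0\<close> holds exactly for constant vectors,
  including the zero vector.\<close>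

definition vec_degree :: "'a::zero poly^'n \<Rightarrow> nat"
  where "vec_degree v = Max (range (\<lambda>i. degree (v $ i)))"

definition outer_prod :: "'a::times^'m \<Rightarrow> 'a^'n \<Rightarrow> 'a^'n^'m"
  where "outer_prod v w = (\<chi> i j. v $ i * w $ j)"

definition scale_mat :: "'a::times \<Rightarrow> 'a^'n^'m \<Rightarrow> 'a^'n^'m"
  where "scale_mat c M = map_matrix ((*) c) M"

end

theory Submission
  imports Defs
begin

text \<open>
  Peel one summand off the pencil at a time, so that the rank over the rational functions
  decreases by at least the amount that the summand contributes to \<open>l + 2 * s\<close>.

  Let \<open>E = A + \<lambda>B\<close> be symmetric and nonzero. There are constant vectors \<open>x\<close> and \<open>v \<noteq> 0\<close> with
  \<open>E x = (a + \<lambda>b) v\<close> and \<open>a + \<lambda>b \<noteq> 0\<close> (\<open>pencil_eigenvector\<close>): a vector that the pencil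
  annihilates at one value of \<open>\<lambda>\<close>, possibly infinite, but not identically. If there is no
  such \<open>x\<close> at infinity, symmetry gives \<open>A = B N\<close> for some matrix \<open>N\<close>, and an eigenvector of \<open>N\<close>
  modulo the kernel of \<open>B\<close> is as desired. Regular and singular pencils are thus treated alike, and
  the Kronecker canonical form does not enter.

  Write \<open>d = a + \<lambda>b\<close> and \<open>\<beta> = v\<^sup>T x\<close>.

  \<^item> If \<open>\<beta> \<noteq> 0\<close>, then \<open>E' = E - (d/\<beta>) v v\<^sup>T\<close> is again a pencil. It annihilates \<open>x\<close>, and its row
    space lies in that of \<open>E\<close>, where \<open>v\<close> is not orthogonal to \<open>x\<close>; so the rank drops by one
    (\<open>rank_minus_square\<close>).

  \<^item> If \<open>\<beta> = 0\<close>, choose a constant \<open>p\<close> with \<open>v\<^sup>T p = 1\<close> and let \<open>P = I - p v\<^sup>T\<close> be the projection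
    onto the hyperplane orthogonal to \<open>v\<close> along \<open>p\<close>. The congruent pencil \<open>E' = P\<^sup>T E P\<close> equals
    \<open>E - v w\<^sup>T - w v\<^sup>T\<close> with \<open>w = E p - (p\<^sup>T E p / 2) v\<close> of degree at most one. It annihilates both
    \<open>x\<close> and \<open>p\<close>, and these cut the row space down twice, so the rank drops by two
    (\<open>rank_minus_hyperbolic\<close>).

  Induction on an upper bound for the rank finishes the proof. Should the pencil vanish before the
  bound is used up, zero terms supply the missing summands.
\<close>

section \<open>Row spaces of symmetric matrices\<close>

lemma scalar_product_add_left: "scalar_product (v + v') w = scalar_product v w + scalar_product v' w"
  by (simp add: scalar_product_def distrib_right sum.distrib)

lemma scalar_product_diff_left:
  "scalar_product (v - v') w = scalar_product v w - scalar_product v' (w :: 'a::ring_1^'n)"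
  by (simp add: scalar_product_def left_diff_distrib sum_subtractf)

lemma scalar_product_scale_left: "scalar_product (c *s v) w = c * scalar_product v w"
  by (simp add: scalar_product_def sum_distrib_left mult.assoc)

lemma scalar_product_zero_left: "scalar_product 0 w = 0"
  by (simp add: scalar_product_def)

lemmas scalar_product_linear_left = scalar_product_add_left scalar_product_diff_left
  scalar_product_scale_left scalar_product_zero_left

lemma scalar_product_commute:
  "scalar_product v w = scalar_product w (v :: 'a::comm_semiring_1^'n)"
  by (simp add: scalar_product_def mult.commute)

lemma symmetric_mat_nth: "symmetric_mat E \<Longrightarrow> E $ i $ j = E $ j $ i"
  unfolding symmetric_mat_def transpose_def by (metis vec_lambda_beta)

lemma scalar_product_symmetric_mat:
  fixes E :: "'a::comm_semiring_1^'n^'n"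
  assumes "symmetric_mat E"
  shows "scalar_product (E *v x) y = scalar_product x (E *v y)"
proof -
  have "scalar_product (E *v x) y = (\<Sum>i\<in>UNIV. \<Sum>j\<in>UNIV. E $ i $ j * x $ j * y $ i)"
    by (simp add: scalar_product_def matrix_vector_mult_def sum_distrib_right)
  also have "\<dots> = (\<Sum>j\<in>UNIV. \<Sum>i\<in>UNIV. E $ i $ j * x $ j * y $ i)"
    by (rule sum.swap)
  also have "\<dots> = scalar_product x (E *v y)"
    by (simp add: scalar_product_def matrix_vector_mult_def sum_distrib_left ac_simps
        symmetric_mat_nth[OF assms])
  finally show ?thesis .
qed

lemma symmetric_mat_mult_in_row_space:
  fixes E :: "'a::field^'n^'n"
  assumes "symmetric_mat E"
  shows "E *v x \<in> vec.span (rows E)"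
proof -
  have "E *v x = (\<Sum>i\<in>UNIV. x $ i *s row i E)"
    by (simp add: vec_eq_iff matrix_vector_mult_def row_def mult.commute
        symmetric_mat_nth[OF assms])
  also have "\<dots> \<in> vec.span (rows E)"
    by (intro vec.span_sum vec.span_scale vec.span_base) (auto simp: rows_def)
  finally show ?thesis .
qed

lemma image_direction_in_row_space:
  fixes E :: "'a::field^'n^'n"
  assumes "symmetric_mat E" and "E *v x = d *s v" and "d \<noteq> 0"
  shows "v \<in> vec.span (rows E)"
proof -
  have "v = inverse d *s (E *v x)"
    using assms(2,3) by (simp add: vec_eq_iff)
  then show ?thesis
    using symmetric_mat_mult_in_row_space[OF assms(1)] by (metis vec.span_scale)
qed

lemma subspace_orthogonal_Int:
  assumes "vec.subspace (T :: ('a::field^'n) set)"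
  shows "vec.subspace {t \<in> T. scalar_product t y = 0}"
  using assms unfolding vec.subspace_def
  by (auto simp: scalar_product_linear_left)

lemma dim_orthogonal_less:
  assumes "vec.subspace (T :: ('a::field^'n) set)" "z \<in> T" "scalar_product z y \<noteq> 0"
  shows "vec.dim {t \<in> T. scalar_product t y = 0} < vec.dim T"
proof (rule vec.dim_psubset)
  have "vec.span {t \<in> T. scalar_product t y = 0} = {t \<in> T. scalar_product t y = 0}"
    by (rule vec.span_eq_iff[THEN iffD2, OF subspace_orthogonal_Int[OF assms(1)]])
  moreover have "vec.span T = T"
    using assms(1) by (rule vec.span_eq_iff[THEN iffD2])
  moreover have "{t \<in> T. scalar_product t y = 0} \<subset> T"
    using assms(2,3) by auto
  ultimately show "vec.span {t \<in> T. scalar_product t y = 0} \<subset> vec.span T"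
    by (simp only:)
qed

lemma rank_le_dim_rows:
  assumes "\<And>i. row i M \<in> T"
  shows "rank (M :: 'a::field^'n^'m) \<le> vec.dim T"
  unfolding row_rank_def_gen using assms by (intro vec.dim_subset) (auto simp: rows_def)

lemma scalar_product_row: "scalar_product (row i M) y = (M *v y) $ i"
  by (simp add: scalar_product_def matrix_vector_mult_def row_def)

lemma outer_prod_mult: 
  "outer_prod v w *v x = scalar_product w x *s (v :: 'a::comm_semiring_1^'n)"
  by (simp add: vec_eq_iff outer_prod_def matrix_vector_mult_def scalar_product_def
      sum_distrib_left ac_simps)

lemma scale_mat_mult: "scale_mat c M *v x = c *s (M *v (x :: 'a::comm_semiring_1^'n))"
  by (simp add: vec_eq_iff scale_mat_def matrix_vector_mult_def sum_distrib_left ac_simps)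

lemma row_outer_prod: "row i (outer_prod v w) = v $ i *s w"
  by (simp add: vec_eq_iff outer_prod_def row_def)

lemma row_scale_mat: "row i (scale_mat c M) = c *s row i M"
  by (simp add: vec_eq_iff scale_mat_def row_def)

lemma row_diff: "row i (M - N) = row i M - row i N"
  by (simp add: vec_eq_iff row_def)

section \<open>Rank drop under subtraction of one or two rank-one terms\<close>

text \<open>
  The new matrix annihilates \<open>x\<close>, so its rows lie in the part of the row space of \<open>E\<close> orthogonal to
  \<open>x\<close>. That part is proper, since \<open>v\<close>, a multiple of \<open>E x\<close>, lies in the row space and \<open>v\<^sup>T x \<noteq> 0\<close>.
\<close>

lemma rank_minus_square:
  fixes E :: "'a::field^'n^'n"
  assumes "symmetric_mat E" and "E *v x = d *s v" and "c * scalar_product v x = d" and "d \<noteq> 0"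
  shows "rank (E - scale_mat c (outer_prod v v)) < rank E" (is "rank ?E' < _")
proof -
  let ?T = "vec.span (rows E)"
  have v: "v \<in> ?T"
    using assms(1,2,4) by (rule image_direction_in_row_space)
  have "?E' *v x = 0"
    using assms(2,3) by (simp add: matrix_vector_mult_diff_rdistrib scale_mat_mult outer_prod_mult)
  then have "scalar_product (row i ?E') x = 0" for i
    by (simp add: scalar_product_row)
  moreover have "row i ?E' \<in> ?T" for i
    unfolding row_diff row_scale_mat row_outer_prod
    by (intro vec.span_diff vec.span_scale v vec.span_base) (auto simp: rows_def)
  ultimately have "rank ?E' \<le> vec.dim {t \<in> ?T. scalar_product t x = 0}"
    by (intro rank_le_dim_rows) blast
  also have "\<dots> < vec.dim ?T"
    using assms(3,4) by (intro dim_orthogonal_less[OF vec.subspace_span v]) auto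
  finally show ?thesis
    by (simp add: row_rank_def_gen)
qed

text \<open>
  The hypotheses on \<open>h\<close> amount to \<open>2h = p\<^sup>T E p\<close>; this form avoids a division by two.
  The rows of the new matrix are orthogonal to \<open>x\<close> and to \<open>p\<close>. Both conditions cost a dimension of
  the row space: \<open>E p\<close> violates the first, and \<open>v\<close> satisfies the first but violates the second.
\<close>

lemma rank_minus_hyperbolic:
  fixes E :: "'a::field^'n^'n"
  assumes "symmetric_mat E" and "E *v x = d *s v" and "d \<noteq> 0" and "scalar_product v x = 0"
    and "scalar_product v p = 1" and "E *v p = w + h *s v" and "scalar_product w p = h"
  shows "rank (E - outer_prod v w - outer_prod w v) + 2 \<le> rank E" (is "rank ?E' + 2 \<le> _")
proof -
  let ?T = "vec.span (rows E)"
  let ?T' = "{t \<in> ?T. scalar_product t x = 0}"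
  have v: "v \<in> ?T"
    using assms(1-3) by (rule image_direction_in_row_space)
  have w: "w \<in> ?T"
  proof -
    have "w = E *v p - h *s v"
      using assms(6) by simp
    then show ?thesis
      using symmetric_mat_mult_in_row_space[OF assms(1)] v by (metis vec.span_scale vec.span_diff)
  qed
  have Epx: "scalar_product (E *v p) x = d"
    using assms(2,5) scalar_product_symmetric_mat[OF assms(1), of p x]
    by (simp add: scalar_product_commute[of p] scalar_product_scale_left)
  then have wx: "scalar_product w x = d"
    using assms(4,6) by (simp add: scalar_product_linear_left)
  have "?E' *v x = 0" "?E' *v p = 0"
    using assms(2,4-7) wx by (simp_all add: matrix_vector_mult_diff_rdistrib outer_prod_mult)
  then have "scalar_product (row i ?E') x = 0" "scalar_product (row i ?E') p = 0" for i
    by (simp_all add: scalar_product_row)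
  moreover have "row i ?E' \<in> ?T" for i
    unfolding row_diff row_outer_prod
    by (intro vec.span_diff vec.span_scale v w vec.span_base) (auto simp: rows_def)
  ultimately have "rank ?E' \<le> vec.dim {t \<in> ?T'. scalar_product t p = 0}"
    by (intro rank_le_dim_rows) blast
  also have "\<dots> < vec.dim ?T'"
    using v assms(4,5) by (intro dim_orthogonal_less[of _ v] subspace_orthogonal_Int) auto
  finally have "rank ?E' < vec.dim ?T'" .
  moreover have "vec.dim ?T' < vec.dim ?T"
    using symmetric_mat_mult_in_row_space[OF assms(1)] Epx assms(3)
    by (intro dim_orthogonal_less[of _ "E *v p"]) auto
  ultimately show ?thesis
    by (simp add: row_rank_def_gen)
qed

section \<open>Constant vectors with image in a constant direction\<close>

text \<open>The vector \<open>p(N) x\<close>, by Horner's scheme.\<close>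

definition poly_orbit :: "'a::field^'n^'n \<Rightarrow> 'a^'n \<Rightarrow> 'a poly \<Rightarrow> 'a^'n"
  where "poly_orbit N x p = fold_coeffs (\<lambda>a v. a *s x + N *v v) p 0"

lemma poly_orbit_0 [simp]: "poly_orbit N x 0 = 0"
  by (simp add: poly_orbit_def)

lemma poly_orbit_pCons [simp]: "poly_orbit N x (pCons a p) = a *s x + N *v poly_orbit N x p"
  by (cases "a = 0 \<and> p = 0") (auto simp: poly_orbit_def)

lemma poly_orbit_add: "poly_orbit N x (p + q) = poly_orbit N x p + poly_orbit N x q"
  by (induction p q rule: poly_induct2)
    (simp_all add: matrix_vector_right_distrib vec.scale_left_distrib algebra_simps)

lemma poly_orbit_smult: "poly_orbit N x (smult c p) = c *s poly_orbit N x p"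
  by (induction p) (simp_all add: vec.scale_right_distrib vec.scale)

lemma poly_orbit_sum: "poly_orbit N x (sum f I) = (\<Sum>i\<in>I. poly_orbit N x (f i))"
  by (induction I rule: infinite_finite_induct) (simp_all add: poly_orbit_add)

text \<open>The vectors \<open>N\<^sup>i x\<close> for \<open>i \<le> n\<close> are too many to be independent in dimension \<open>n\<close>.\<close>

lemma exists_annihilating_poly:
  fixes N :: "'a::field^'n^'n"
  shows "\<exists>p. p \<noteq> 0 \<and> poly_orbit N x p = 0"
proof -
  define y where "y i = poly_orbit N x (monom 1 i)" for i
  let ?I = "{..CARD('n)}"
  show ?thesis
  proof (cases "inj_on y ?I")
    case False
    then obtain i j where ij: "i \<noteq> j" "y i = y j"
      by (auto simp: inj_on_def)
    have "poly_orbit N x (monom 1 i + smult (-1) (monom 1 j)) = 0"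
      using ij(2) unfolding poly_orbit_add poly_orbit_smult y_def
      by (simp add: vec_eq_iff)
    moreover have "coeff (monom 1 i + smult (-1) (monom 1 j)) i \<noteq> (0 :: 'a)"
      using ij(1) by simp
    ultimately show ?thesis
      by (metis coeff_0)
  next
    case True
    have "vec.dim (y ` ?I) < card (y ` ?I)"
      using dim_subset_UNIV_cart_gen[of "y ` ?I"] by (simp add: card_image[OF True])
    then have "vec.dependent (y ` ?I)"
      by (rule vec.dependent_biggerset_general)
    then obtain f where f: "(\<Sum>z\<in>y ` ?I. f z *s z) = 0" "\<exists>z\<in>y ` ?I. f z \<noteq> 0"
      using vec.dependent_finite[of "y ` ?I"] by auto
    define p where "p = (\<Sum>i\<in>?I. monom (f (y i)) i)"
    have "poly_orbit N x (monom a i) = a *s y i" for a i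
      using poly_orbit_smult[of N x a "monom 1 i"] by (simp add: y_def smult_monom)
    then have "poly_orbit N x p = (\<Sum>z\<in>y ` ?I. f z *s z)"
      by (simp add: p_def poly_orbit_sum sum.reindex[OF True])
    moreover obtain k where "k \<in> ?I" "f (y k) \<noteq> 0"
      using f(2) by auto
    then have "coeff p k \<noteq> 0"
      by (auto simp: p_def coeff_sum coeff_monom)
    ultimately show ?thesis
      using f(1) by (metis coeff_0)
  qed
qed

text \<open>
  Take \<open>p \<noteq> 0\<close> of least degree with \<open>p(N) x \<in> W\<close> and split off a linear factor,
  \<open>p = (X - \<mu>) q\<close>; then \<open>z = q(N) x\<close> is outside \<open>W\<close> by minimality. With \<open>W = 0\<close> this is the usual
  existence of an eigenvector; the subspace \<open>W\<close> stands in for passing to a quotient space.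
\<close>

lemma exists_eigenvector_modulo:
  fixes N :: "complex^'n^'n"
  assumes W: "vec.subspace W" and "x \<notin> W"
  shows "\<exists>z \<mu>. z \<notin> W \<and> N *v z - \<mu> *s z \<in> W"
proof -
  let ?P = "\<lambda>p. p \<noteq> 0 \<and> poly_orbit N x p \<in> W"
  obtain p where p: "?P p" and min: "\<And>q. ?P q \<Longrightarrow> degree p \<le> degree q"
    using exists_annihilating_poly[of N x] vec.subspace_0[OF W]
      ex_has_least_nat[of ?P _ degree] by metis
  show ?thesis
    \<comment> \<open>a constant \<open>p\<close> would put \<open>x\<close> itself into \<open>W\<close>\<close>
  proof (cases "degree p = 0")
    case True
    then obtain c where c: "p = [:c:]" "c \<noteq> 0"
      using p by (metis degree_eq_zeroE pCons_eq_0_iff)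
    then have "c *s x \<in> W"
      using p by simp
    moreover have "x = inverse c *s (c *s x)"
      using c(2) by (simp add: vec_eq_iff)
    ultimately have "x \<in> W"
      using vec.subspace_scale[OF W] by metis
    with assms(2) show ?thesis
      by contradiction
  next
    case False
    then obtain \<mu> where "poly p \<mu> = 0"
      using fundamental_theorem_of_algebra constant_degree by metis
    then obtain q where q: "p = [:-\<mu>, 1:] * q"
      by (metis dvdE poly_eq_0_iff_dvd)
    have q0: "q \<noteq> 0"
      using p q by auto
    then have "degree q < degree p"
      unfolding q by (subst degree_mult_eq) auto
    then have "poly_orbit N x q \<notin> W"
      using min[of q] q0 by force
    moreover have "p = pCons 0 q + smult (- \<mu>) q"
      by (simp add: q)
    then have "N *v poly_orbit N x q - \<mu> *s poly_orbit N x q = poly_orbit N x p"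
      by (simp only: poly_orbit_add poly_orbit_smult poly_orbit_pCons) (simp add: vec_eq_iff)
    ultimately show ?thesis
      using p by metis
  qed
qed

text \<open>
  If the kernel of \<open>B\<close> is not contained in that of \<open>A\<close>, a vector of the difference works, with
  \<open>b = 0\<close>. Otherwise \<open>A\<close> factors through \<open>B\<close> as \<open>A = M B\<close>, and transposing gives \<open>A = B N\<close>; this
  is where symmetry enters. For \<open>z\<close> outside the kernel of \<open>B\<close> and \<open>N z - \<mu> z\<close> inside it,
  \<open>A z = B N z = \<mu> B z\<close>.
\<close>

lemma pencil_eigenvector:
  fixes A B :: "complex^'n^'n"
  assumes "symmetric_mat A" "symmetric_mat B" and "A \<noteq> 0 \<or> B \<noteq> 0"
  shows "\<exists>x v a b. v \<noteq> 0 \<and> (a \<noteq> 0 \<or> b \<noteq> 0) \<and> A *v x = a *s v \<and> B *v x = b *s v"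
proof (cases "\<exists>x. B *v x = 0 \<and> A *v x \<noteq> 0")
  case True
  then obtain x where "B *v x = 0" "A *v x \<noteq> 0" by blast
  then show ?thesis
    by (intro exI[of _ x] exI[of _ "A *v x"] exI[of _ 1] exI[of _ 0]) simp
next
  case False
  then have ker: "A *v x = 0" if "B *v x = 0" for x
    using that by blast
  \<comment> \<open>a generalized inverse of \<open>B\<close>, so that \<open>M = A G\<close>\<close>
  obtain g where g: "Vector_Spaces.linear (*s) (*s) g" "\<And>x. B *v g (B *v x) = B *v x"
    using vec.linear_exists_right_inverse_on[OF matrix_vector_mul_linear_gen vec.subspace_UNIV, of B]
    by auto
  define G where "G = matrix g"
  have G: "G *v x = g x" for x
    unfolding G_def using g(1) by (rule matrix_works)
  have "A *v x = (A ** G ** B) *v x" for x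
  proof -
    have "B *v (g (B *v x) - x) = 0"
      by (simp add: g(2) matrix_vector_mult_diff_distrib)
    then have "A *v (g (B *v x) - x) = 0"
      by (rule ker)
    then show ?thesis
      by (simp add: matrix_vector_mult_diff_distrib G flip: matrix_vector_mul_assoc)
  qed
  then have "A = A ** G ** B"
    by (simp add: matrix_eq)
  then have "transpose A = transpose (A ** G ** B)"
    by simp
  then have AB: "A = B ** (transpose G ** A)"
    using assms(1,2) by (simp add: matrix_transpose_mul symmetric_mat_def)
  obtain x where "B *v x \<noteq> 0"
    using assms(3) ker by (auto simp: matrix_eq)
  then obtain z \<mu> where z: "B *v z \<noteq> 0" "B *v ((transpose G ** A) *v z - \<mu> *s z) = 0"
    using exists_eigenvector_modulo[of "{z. B *v z = 0}" x "transpose G ** A"]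
    by (auto simp: vec.subspace_def matrix_vector_right_distrib vec.scale)
  have "A *v z = \<mu> *s (B *v z)"
    using z(2) AB by (simp add: matrix_vector_mult_diff_distrib matrix_vector_mul_assoc vec.scale)
  with z(1) show ?thesis
    by (intro exI[of _ z] exI[of _ "B *v z"] exI[of _ \<mu>] exI[of _ 1]) simp
qed

section \<open>Decompositions of polynomial matrices\<close>

definition pencil_vec :: "'a::zero^'n \<Rightarrow> 'a^'n \<Rightarrow> 'a poly^'n"
  where "pencil_vec p q = (\<chi> i. [:p $ i, q $ i:])"

definition fract_vec :: "'a::idom^'n \<Rightarrow> 'a fract^'n"
  where "fract_vec p = (\<chi> i. to_fract (p $ i))"

text \<open>
  The number \<open>r\<close> counts the summands, a symmetric pair \<open>v w\<^sup>T + w v\<^sup>T\<close> twice, and is not tied to the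
  rank of \<open>E\<close>; this allows summands to be added one by one.
\<close>

definition decomposable :: "complex poly^'n^'n \<Rightarrow> nat \<Rightarrow> bool"
  where "decomposable E r \<longleftrightarrow>
    (\<exists>(l::nat) (s::nat) (a :: nat \<Rightarrow> complex) (b :: nat \<Rightarrow> complex)
           (u :: nat \<Rightarrow> complex poly^'n) (v :: nat \<Rightarrow> complex poly^'n) (w :: nat \<Rightarrow> complex poly^'n).
      E = (\<Sum>i=1..l. scale_mat [:a i, b i:] (outer_prod (u i) (u i)))
        + (\<Sum>j=1..s. outer_prod (v j) (w j))
        + (\<Sum>j=1..s. outer_prod (w j) (v j))
      \<and> l + 2 * s = r
      \<and> (\<forall>i\<in>{1..l}. vec_degree (u i) = 0)
      \<and> (\<forall>j\<in>{1..s}. vec_degree (v j) = 0)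
      \<and> (\<forall>j\<in>{1..s}. vec_degree (w j) \<le> 1))"

lemma vec_degree_le_iff: "vec_degree v \<le> k \<longleftrightarrow> (\<forall>i. degree (v $ i) \<le> k)"
  unfolding vec_degree_def by (subst Max_le_iff) auto

lemma vec_degree_pencil_vec: "vec_degree (pencil_vec p q) \<le> 1"
  by (simp add: vec_degree_le_iff pencil_vec_def)

lemma vec_degree_const: "vec_degree (pencil_vec p 0) = 0"
  using vec_degree_le_iff[of "pencil_vec p 0" 0] by (simp add: pencil_vec_def)

text \<open>Zero terms count as summands, so a pencil whose rank is below the bound still qualifies.\<close>

lemma decomposable_zero: "decomposable 0 r"
proof -
  have "vec_degree (0 :: complex poly^'n) = 0"
    using vec_degree_const[of "0 :: complex^'n"] by (simp add: pencil_vec_def zero_vec_def)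
  then show ?thesis
    unfolding decomposable_def
    by (intro exI[of _ r] exI[of _ "0::nat"] exI[of _ "\<lambda>_. 0"])
      (auto simp: outer_prod_def scale_mat_def vec_eq_iff)
qed

lemma decomposable_add_square:
  assumes "decomposable E r" and "vec_degree u' = 0"
  shows "decomposable (E + scale_mat [:a', b':] (outer_prod u' u')) (Suc r)"
proof -
  obtain l s a b u v w where E:
    "E = (\<Sum>i=1..l. scale_mat [:a i, b i:] (outer_prod (u i) (u i)))
        + (\<Sum>j=1..s. outer_prod (v j) (w j)) + (\<Sum>j=1..s. outer_prod (w j) (v j))"
    "l + 2 * s = r" "\<forall>i\<in>{1..l}. vec_degree (u i) = 0"
    "\<forall>j\<in>{1..s}. vec_degree (v j) = 0" "\<forall>j\<in>{1..s}. vec_degree (w j) \<le> 1"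
    using assms(1) unfolding decomposable_def by blast
  let ?a = "a(Suc l := a')" and ?b = "b(Suc l := b')" and ?u = "u(Suc l := u')"
  have "(\<Sum>i=1..l. scale_mat [:?a i, ?b i:] (outer_prod (?u i) (?u i)))
      = (\<Sum>i=1..l. scale_mat [:a i, b i:] (outer_prod (u i) (u i)))"
    by (intro sum.cong) auto
  then have "E + scale_mat [:a', b':] (outer_prod u' u')
      = (\<Sum>i=1..Suc l. scale_mat [:?a i, ?b i:] (outer_prod (?u i) (?u i)))
        + (\<Sum>j=1..s. outer_prod (v j) (w j)) + (\<Sum>j=1..s. outer_prod (w j) (v j))"
    by (simp add: E(1) ac_simps)
  moreover have "\<forall>i\<in>{1..Suc l}. vec_degree (?u i) = 0"
    using E(3) assms(2) by auto
  ultimately show ?thesis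
    unfolding decomposable_def using E(2,4,5)
    by (intro exI[of _ "Suc l"] exI[of _ s] exI[of _ ?a] exI[of _ ?b] exI[of _ ?u]
        exI[of _ v] exI[of _ w]) (intro conjI; simp)
qed

lemma decomposable_add_hyperbolic:
  assumes "decomposable E r" and "vec_degree v' = 0" and "vec_degree w' \<le> 1"
  shows "decomposable (E + outer_prod v' w' + outer_prod w' v') (Suc (Suc r))"
proof -
  obtain l s a b u v w where E:
    "E = (\<Sum>i=1..l. scale_mat [:a i, b i:] (outer_prod (u i) (u i)))
        + (\<Sum>j=1..s. outer_prod (v j) (w j)) + (\<Sum>j=1..s. outer_prod (w j) (v j))"
    "l + 2 * s = r" "\<forall>i\<in>{1..l}. vec_degree (u i) = 0"
    "\<forall>j\<in>{1..s}. vec_degree (v j) = 0" "\<forall>j\<in>{1..s}. vec_degree (w j) \<le> 1"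
    using assms(1) unfolding decomposable_def by blast
  let ?v = "v(Suc s := v')" and ?w = "w(Suc s := w')"
  have "(\<Sum>j=1..s. outer_prod (?v j) (?w j)) = (\<Sum>j=1..s. outer_prod (v j) (w j))"
    "(\<Sum>j=1..s. outer_prod (?w j) (?v j)) = (\<Sum>j=1..s. outer_prod (w j) (v j))"
    by (intro sum.cong; auto)+
  then have "E + outer_prod v' w' + outer_prod w' v'
      = (\<Sum>i=1..l. scale_mat [:a i, b i:] (outer_prod (u i) (u i)))
        + (\<Sum>j=1..Suc s. outer_prod (?v j) (?w j)) + (\<Sum>j=1..Suc s. outer_prod (?w j) (?v j))"
    by (simp add: E(1) ac_simps)
  moreover have "\<forall>j\<in>{1..Suc s}. vec_degree (?v j) = 0" "\<forall>j\<in>{1..Suc s}. vec_degree (?w j) \<le> 1"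
    using E(4,5) assms(2,3) by auto
  ultimately show ?thesis
    unfolding decomposable_def using E(2,3)
    by (intro exI[of _ l] exI[of _ "Suc s"] exI[of _ a] exI[of _ b] exI[of _ u]
        exI[of _ ?v] exI[of _ ?w]) (intro conjI; simp)
qed

section \<open>Pencils over the field of rational functions\<close>

lemma sum_linear_poly: "(\<Sum>i\<in>I. [:f i, g i:]) = [:sum f I, sum g I:]"
  by (induction I rule: infinite_finite_induct) auto

lemma fract_pencil_mult:
  "map_matrix to_fract (pencil A B) *v fract_vec (pencil_vec x 0)
    = fract_vec (pencil_vec (A *v x) (B *v x))"
  by (simp add: vec_eq_iff matrix_vector_mult_def fract_vec_def pencil_vec_def pencil_def
      mult.commute flip: to_fract_mult to_fract_sum sum_linear_poly)

lemma scalar_product_fract_vec: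
  "scalar_product (fract_vec (pencil_vec p q)) (fract_vec (pencil_vec x 0))
    = to_fract [:scalar_product p x, scalar_product q x:]"
  by (simp add: scalar_product_def fract_vec_def pencil_vec_def mult.commute
      flip: to_fract_mult to_fract_sum sum_linear_poly)

lemma fract_vec_pencil_vec_scale:
  "fract_vec (pencil_vec (a *s v) (b *s v)) = to_fract [:a, b:] *s fract_vec (pencil_vec v 0)"
  by (simp add: vec_eq_iff fract_vec_def pencil_vec_def mult.commute flip: to_fract_mult)

lemma symmetric_mat_fract_pencil:
  "symmetric_mat A \<Longrightarrow> symmetric_mat B \<Longrightarrow> symmetric_mat (map_matrix to_fract (pencil A B))"
  by (simp add: symmetric_mat_def transpose_def vec_eq_iff pencil_def)

section \<open>Peeling off summands\<close>

text \<open>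
  A bound on the rank, rather than its exact value, is what the induction needs, since the rank
  lemmas only bound the drop from below.
\<close>

lemma symmetric_pencil_decomposable:
  fixes A B :: "complex^'n^'n"
  assumes "symmetric_mat A" and "symmetric_mat B" and "normal_rank (pencil A B) \<le> r"
  shows "decomposable (pencil A B) r"
  using assms
proof (induction r arbitrary: A B rule: less_induct)
  case (less r)
  note symA = less.prems(1) and symB = less.prems(2)
  let ?E = "map_matrix to_fract (pencil A B)"
  show ?case
  proof (cases "A = 0 \<and> B = 0")
    case True
    then have "pencil A B = 0"
      by (simp add: pencil_def vec_eq_iff)
    then show ?thesis
      by (simp add: decomposable_zero)
  next
    case False
    then obtain x v a b where v: "v \<noteq> 0" and ab: "a \<noteq> 0 \<or> b \<noteq> 0"
      and Ax: "A *v x = a *s v" and Bx: "B *v x = b *s v"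
      using pencil_eigenvector[OF symA symB] by blast
    let ?x = "fract_vec (pencil_vec x 0)" and ?v = "fract_vec (pencil_vec v 0)"
    let ?d = "to_fract [:a, b:]"
    have symE: "symmetric_mat ?E"
      using symA symB by (rule symmetric_mat_fract_pencil)
    have Ex: "?E *v ?x = ?d *s ?v"
      by (simp add: fract_pencil_mult Ax Bx fract_vec_pencil_vec_scale)
    have d: "?d \<noteq> 0"
      using ab by auto
    have vx: "scalar_product ?v ?x = to_fract [:scalar_product v x:]"
      by (simp add: scalar_product_fract_vec scalar_product_zero_left)
    show ?thesis
    proof (cases "scalar_product v x = 0")
      case False
      define \<beta> where "\<beta> = scalar_product v x"
      have \<beta>: "\<beta> \<noteq> 0"
        using False by (simp add: \<beta>_def)
      define A' where "A' = A - scale_mat (a / \<beta>) (outer_prod v v)"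
      define B' where "B' = B - scale_mat (b / \<beta>) (outer_prod v v)"
      let ?S = "scale_mat [:a / \<beta>, b / \<beta>:] (outer_prod (pencil_vec v 0) (pencil_vec v 0))"
      have split: "pencil A B = pencil A' B' + ?S"
        by (simp add: vec_eq_iff pencil_def A'_def B'_def scale_mat_def outer_prod_def
            pencil_vec_def algebra_simps)
      have "map_matrix to_fract (pencil A' B')
          = ?E - scale_mat (to_fract [:a / \<beta>, b / \<beta>:]) (outer_prod ?v ?v)"
        by (simp add: vec_eq_iff split scale_mat_def outer_prod_def fract_vec_def
            del: mult_pCons_left)
      moreover have "to_fract [:a / \<beta>, b / \<beta>:] * scalar_product ?v ?x = ?d"
        using \<beta> by (simp add: vx \<beta>_def[symmetric] flip: to_fract_mult)
      ultimately have "normal_rank (pencil A' B') < normal_rank (pencil A B)"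
        unfolding normal_rank_def using rank_minus_square[OF symE Ex _ d] by simp
      then have "r \<noteq> 0" "normal_rank (pencil A' B') \<le> r - 1"
        using less.prems(3) by auto
      moreover have "symmetric_mat A'" "symmetric_mat B'"
        using symA symB by (simp_all add: A'_def B'_def symmetric_mat_def transpose_def vec_eq_iff
            scale_mat_def outer_prod_def mult.commute)
      ultimately have "decomposable (pencil A' B') (r - 1)"
        using less.IH[of "r - 1" A' B'] by simp
      then have "decomposable (pencil A' B' + ?S) (Suc (r - 1))"
        by (rule decomposable_add_square) (rule vec_degree_const)
      with \<open>r \<noteq> 0\<close> show ?thesis
        by (simp add: split)
    next
      case True
      obtain k where k: "v $ k \<noteq> 0"
        using v by (auto simp: vec_eq_iff)
      define p where "p = axis k (1 / v $ k)"
      have vp: "scalar_product v p = 1"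
        using k by (simp add: scalar_product_def p_def axis_def if_distrib cong: if_cong)
      \<comment> \<open>\<open>c + \<lambda>d\<close> is \<open>w\<close>, and \<open>g + \<lambda>h\<close> is half of \<open>p\<^sup>T E p\<close>, which makes \<open>w\<^sup>T p = g + \<lambda>h\<close>\<close>
      define g where "g = scalar_product (A *v p) p / 2"
      define h where "h = scalar_product (B *v p) p / 2"
      define c where "c = A *v p - g *s v"
      define d where "d = B *v p - h *s v"
      define A' where "A' = A - outer_prod v c - outer_prod c v"
      define B' where "B' = B - outer_prod v d - outer_prod d v"
      let ?V = "pencil_vec v 0" and ?W = "pencil_vec c d"
      let ?p = "fract_vec (pencil_vec p 0)" and ?w = "fract_vec ?W"
      have split: "pencil A B = pencil A' B' + outer_prod ?V ?W + outer_prod ?W ?V"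
        by (simp add: vec_eq_iff pencil_def A'_def B'_def outer_prod_def
            pencil_vec_def algebra_simps)
      have "map_matrix to_fract (pencil A' B') = ?E - outer_prod ?v ?w - outer_prod ?w ?v"
        by (simp add: vec_eq_iff split outer_prod_def fract_vec_def)
      moreover have "?E *v ?p = ?w + to_fract [:g, h:] *s ?v"
        unfolding fract_pencil_mult
        by (simp add: vec_eq_iff fract_vec_def pencil_vec_def c_def d_def mult.commute 
            flip: to_fract_mult to_fract_add)
      moreover have "scalar_product ?w ?p = to_fract [:g, h:]"
        by (simp add: scalar_product_fract_vec c_def d_def scalar_product_linear_left vp)
          (simp add: g_def h_def)
      moreover have "scalar_product ?v ?p = 1"
        by (simp add: scalar_product_fract_vec vp scalar_product_zero_left flip: one_pCons)
      moreover have "scalar_product ?v ?x = 0"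
        by (simp add: vx True)
      ultimately have "normal_rank (pencil A' B') + 2 \<le> normal_rank (pencil A B)"
        unfolding normal_rank_def using rank_minus_hyperbolic[OF symE Ex \<open>?d \<noteq> 0\<close>] by simp
      then have "r \<ge> 2" "normal_rank (pencil A' B') \<le> r - 2"
        using less.prems(3) by auto
      moreover have "symmetric_mat A'" "symmetric_mat B'"
        using symA symB by (simp_all add: A'_def B'_def symmetric_mat_def transpose_def vec_eq_iff
            outer_prod_def mult.commute)
      ultimately have "decomposable (pencil A' B') (r - 2)"
        using less.IH[of "r - 2" A' B'] by simp
      then have "decomposable (pencil A' B' + outer_prod ?V ?W + outer_prod ?W ?V) (Suc (Suc (r - 2)))"
        by (rule decomposable_add_hyperbolic) (rule vec_degree_const vec_degree_pencil_vec)+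
      moreover have "Suc (Suc (r - 2)) = r"
        using \<open>r \<ge> 2\<close> by simp
      ultimately show ?thesis
        by (simp add: split)
    qed
  qed
qed

theorem theorem4:
  fixes A B :: "complex^'n^'n" and r :: nat
  assumes "symmetric_mat A" and "symmetric_mat B"
    and "normal_rank (pencil A B) = r" and "r \<le> CARD('n)"
  shows "\<exists>(l::nat) (s::nat) (a :: nat \<Rightarrow> complex) (b :: nat \<Rightarrow> complex)
           (u :: nat \<Rightarrow> complex poly^'n) (v :: nat \<Rightarrow> complex poly^'n) (w :: nat \<Rightarrow> complex poly^'n).
      pencil A B =
          (\<Sum>i=1..l. scale_mat [:a i, b i:] (outer_prod (u i) (u i)))
        + (\<Sum>j=1..s. outer_prod (v j) (w j))
        + (\<Sum>j=1..s. outer_prod (w j) (v j))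
      \<and> l + 2 * s = r
      \<and> (\<forall>i\<in>{1..l}. vec_degree (u i) = 0)
      \<and> (\<forall>j\<in>{1..s}. vec_degree (v j) = 0)
      \<and> (\<forall>j\<in>{1..s}. vec_degree (w j) \<le> 1)"
  using symmetric_pencil_decomposable[OF assms(1,2) eq_imp_le[OF assms(3)]]
  unfolding decomposable_def .

end
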